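(* Let $1<p<\infty$, let $G$ be a locally compact group, and let $\mathrm{S}\mathrm{A}_p(G)$ be a Segal algebra in $\mathrm{A}_p(G)$ such that: - it is closed under left translations: $t*u\in\mathrm{S}\mathrm{A}_p(G)$ for $t\in G$ and $u\in\mathrm{S}\mathrm{A}_p(G)$; - translations are continuous on $G$: $t\mapsto t*u:G\to\mathrm{S}\mathrm{A}_p(G)$ is continuous for each $u\in\mathrm{S}\mathrm{A}_p(G)$; and - translations are bounded on $G$: $\sup_{t\in G}\|t*u\|_{\mathrm{S}\mathrm{A}_p}<\infty$ for each $u\in\mathrm{S}\mathrm{A}_p(G)$. Then $\mathrm{S}\mathrm{A}_p(G)\supset\mathrm{S}_0^p(G)$.
   Context: $\frac1p+\frac1{p'}=1$. $\mathrm{A}_p(G)$ is the Figà-Talamanca–Herz algebra: the functions $\sum_i\xi_i*\check\eta_i$ with $\xi_i\in L^{p'}(G)$, $\eta_i\in L^p(G)$, $\sum_i\|\xi_i\|_{p'}\|\eta_i\|_p<\infty$ (where $\check\eta(s)=\eta(s^{-1})$), normed by the infimum of these sums; it is a Banach algebra under pointwise operations. Left translation is $(t*u)(s)=u(t^{-1}s)$. A Segal algebra in a Banach algebra $\mathcal{A}$ is a dense (left) ideal $\mathrm{S}\mathcal{A}$ of $\mathcal{A}$ which is a Banach space under a norm $\|\cdot\|_{\mathrm{S}\mathcal{A}}$ for which the inclusion $\mathrm{S}\mathcal{A}\hookrightarrow\mathcal{A}$ is bounded and the module multiplication $\mathcal{A}\times\mathrm{S}\mathcal{A}\to\mathrm{S}\mathcal{A}$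 is bounded. $\mathrm{S}_0^p(G)$ (the $p$-Feichtinger Segal algebra), as a space of functions: fix a compact $K\subset G$ with non-empty interior and let $\mathrm{A}_p^K(G)=\{u\in\mathrm{A}_p(G):\operatorname{supp}u\subset K\}$ with the norm of $\mathrm{A}_p(G)$; then $\mathrm{S}_0^p(G)=\{\sum_{t\in G}t*v_t: v_t\in\mathrm{A}_p^K(G),\ \sum_{t\in G}\|v_t\|_{\mathrm{A}_p}<\infty\}$. (As a set it does not depend on the choice of $K$; more generally $\mathrm{A}_p^K(G)$ may be replaced by any non-zero compactly supported $p$-operator Segal ideal of $\mathrm{A}_p(G)$.) *)

theory Defs
  imports "HOL-Analysis.Analysis" "HOL-Library.Function_Algebras"
begin

text \<open>
  The group is a type of class \<^class>\<open>topological_group_add\<close>. It is written additively but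
  is not assumed commutative: \<open>s + t\<close>, \<open>- s\<close>, \<open>0\<close> stand for the product, the inverse and
  the neutral element. Algebra operations on complex functions are pointwise
  (\<^theory>\<open>HOL-Library.Function_Algebras\<close>).
\<close>

definition left_haar_measure :: "'g::topological_group_add measure \<Rightarrow> bool" where
  "left_haar_measure m \<longleftrightarrow>
     sets m = sets borel \<and>
     emeasure m UNIV \<noteq> 0 \<and>
     (\<forall>C. compact C \<longrightarrow> emeasure m C < \<infinity>) \<and>
     (\<forall>A\<in>sets borel. emeasure m A = (INF U\<in>{U. open U \<and> A \<subseteq> U}. emeasure m U)) \<and>
     (\<forall>U. open U \<longrightarrow> emeasure m U = (SUP C\<in>{C. compact C \<and> C \<subseteq> U}. emeasure m C)) \<and>
     (\<forall>t. \<forall>A\<in>sets borel. emeasure m ((\<lambda>s. t + s) ` A) = emeasure m A)"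

definition conj_exponent :: "real \<Rightarrow> real" where
  "conj_exponent p = p / (p - 1)"

lemma conj_exponent: "1 < p \<Longrightarrow> 1 / p + 1 / conj_exponent p = 1"
  by (simp add: conj_exponent_def field_simps)

definition Lp_space :: "'g measure \<Rightarrow> real \<Rightarrow> ('g \<Rightarrow> complex) set" where
  "Lp_space m p = {f \<in> borel_measurable m. integrable m (\<lambda>s. norm (f s) powr p)}"

definition Lp_norm :: "'g measure \<Rightarrow> real \<Rightarrow> ('g \<Rightarrow> complex) \<Rightarrow> real" where
  "Lp_norm m p f = (LINT s|m. norm (f s) powr p) powr (1 / p)"

definition translate :: "'g::group_add \<Rightarrow> ('g \<Rightarrow> complex) \<Rightarrow> 'g \<Rightarrow> complex" where
  "translate t u = (\<lambda>s. u (- t + s))"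

definition check :: "('g::group_add \<Rightarrow> complex) \<Rightarrow> 'g \<Rightarrow> complex" where
  "check f = (\<lambda>s. f (- s))"

definition conv :: "'g::group_add measure \<Rightarrow> ('g \<Rightarrow> complex) \<Rightarrow> ('g \<Rightarrow> complex) \<Rightarrow> 'g \<Rightarrow> complex" where
  "conv m f g = (\<lambda>s. LINT t|m. f t * g (- t + s))"

text \<open>
  By Hoelder's inequality each term \<open>conv m (\<xi> i) (check (\<eta> i)) s\<close> is bounded in modulus by
  the product of the norms, so the pointwise series below converges absolutely and uniformly.
  Rescaling the Haar measure changes neither \<open>Ap\<close> nor \<open>Ap_norm\<close>.
\<close>

definition Ap_represents ::
  "'g::group_add measure \<Rightarrow> real \<Rightarrow> (nat \<Rightarrow> 'g \<Rightarrow> complex) \<Rightarrow> (nat \<Rightarrow> 'g \<Rightarrow> complex) \<Rightarrow> ('g \<Rightarrow> complex) \<Rightarrow> bool"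
  where
  "Ap_represents m p \<xi> \<eta> u \<longleftrightarrow>
     (\<forall>i. \<xi> i \<in> Lp_space m (conj_exponent p)) \<and>
     (\<forall>i. \<eta> i \<in> Lp_space m p) \<and>
     summable (\<lambda>i. Lp_norm m (conj_exponent p) (\<xi> i) * Lp_norm m p (\<eta> i)) \<and>
     (\<forall>s. (\<lambda>i. conv m (\<xi> i) (check (\<eta> i)) s) sums u s)"

definition Ap :: "'g::group_add measure \<Rightarrow> real \<Rightarrow> ('g \<Rightarrow> complex) set" where
  "Ap m p = {u. \<exists>\<xi> \<eta>. Ap_represents m p \<xi> \<eta> u}"

definition Ap_norm :: "'g::group_add measure \<Rightarrow> real \<Rightarrow> ('g \<Rightarrow> complex) \<Rightarrow> real" where
  "Ap_norm m p u =
     Inf {(\<Sum>i. Lp_norm m (conj_exponent p) (\<xi> i) * Lp_norm m p (\<eta> i)) |\<xi> \<eta>. Ap_represents m p \<xi> \<eta> u}"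

definition function_subspace :: "('x \<Rightarrow> complex) set \<Rightarrow> bool" where
  "function_subspace S \<longleftrightarrow>
     0 \<in> S \<and> (\<forall>u\<in>S. \<forall>v\<in>S. u + v \<in> S) \<and> (\<forall>c. \<forall>u\<in>S. (\<lambda>s. c * u s) \<in> S)"

definition norm_on :: "('x \<Rightarrow> complex) set \<Rightarrow> (('x \<Rightarrow> complex) \<Rightarrow> real) \<Rightarrow> bool" where
  "norm_on S N \<longleftrightarrow>
     (\<forall>u\<in>S. 0 \<le> N u) \<and>
     (\<forall>u\<in>S. N u = 0 \<longleftrightarrow> u = 0) \<and>
     (\<forall>c. \<forall>u\<in>S. N (\<lambda>s. c * u s) = norm c * N u) \<and>
     (\<forall>u\<in>S. \<forall>v\<in>S. N (u + v) \<le> N u + N v)"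

definition complete_in_norm :: "('x \<Rightarrow> complex) set \<Rightarrow> (('x \<Rightarrow> complex) \<Rightarrow> real) \<Rightarrow> bool" where
  "complete_in_norm S N \<longleftrightarrow>
     (\<forall>f::nat \<Rightarrow> 'x \<Rightarrow> complex.
        (\<forall>n. f n \<in> S) \<longrightarrow>
        (\<forall>e>0. \<exists>M. \<forall>i\<ge>M. \<forall>j\<ge>M. N (f i - f j) < e) \<longrightarrow>
        (\<exists>u\<in>S. (\<lambda>n. N (f n - u)) \<longlonglongrightarrow> 0))"

definition banach_function_space :: "('x \<Rightarrow> complex) set \<Rightarrow> (('x \<Rightarrow> complex) \<Rightarrow> real) \<Rightarrow> bool" where
  "banach_function_space S N \<longleftrightarrow> function_subspace S \<and> norm_on S N \<and> complete_in_norm S N"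

text \<open>
  \<open>(A, NA)\<close> is meant to be a Banach algebra of functions under pointwise operations; this is
  deliberately not part of the definition, so that using it does not assume it of \<open>A\<close>.
  The algebra is commutative, so left ideals are ideals.
\<close>

definition segal_algebra ::
  "('x \<Rightarrow> complex) set \<Rightarrow> (('x \<Rightarrow> complex) \<Rightarrow> real) \<Rightarrow> ('x \<Rightarrow> complex) set \<Rightarrow> (('x \<Rightarrow> complex) \<Rightarrow> real) \<Rightarrow> bool"
  where
  "segal_algebra A NA S NS \<longleftrightarrow>
     S \<subseteq> A \<and>
     banach_function_space S NS \<and>
     (\<forall>a\<in>A. \<forall>u\<in>S. a * u \<in> S) \<and>
     (\<forall>a\<in>A. \<forall>e>0. \<exists>u\<in>S. NA (a - u) < e) \<and>
     (\<exists>C. \<forall>u\<in>S. NA u \<le> C * NS u) \<and>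
     (\<exists>C. \<forall>a\<in>A. \<forall>u\<in>S. NS (a * u) \<le> C * NA a * NS u)"

definition supp :: "('g::topological_space \<Rightarrow> complex) \<Rightarrow> 'g set" where
  "supp u = closure {s. u s \<noteq> 0}"

definition Ap_supported :: "'g::topological_group_add measure \<Rightarrow> real \<Rightarrow> 'g set \<Rightarrow> ('g \<Rightarrow> complex) set" where
  "Ap_supported m p K = {u \<in> Ap m p. supp u \<subseteq> K}"

text \<open>
  The \<open>Ap_norm\<close> dominates the supremum norm, so the sum of the translates, which converges
  absolutely in \<open>Ap\<close>, is determined by its pointwise values.
\<close>

definition S0p :: "'g::topological_group_add measure \<Rightarrow> real \<Rightarrow> 'g set \<Rightarrow> ('g \<Rightarrow> complex) set" where
  "S0p m p K =
     {u. \<exists>v. (\<forall>t. v t \<in> Ap_supported m p K) \<and>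
             (\<lambda>t. Ap_norm m p (v t)) summable_on UNIV \<and>
             (\<forall>s. ((\<lambda>t. translate t (v t) s) has_sum u s) UNIV)}"

end

theory Submission
  imports Defs
begin

text \<open>
  The Segal algebra \<open>S\<close> contains some \<open>w\<close> that equals 1 on \<open>K\<close>. For \<open>v\<close> supported in \<open>K\<close> every
  translate factors as \<open>t * v = (t * v) (t * w)\<close>, so it lies in \<open>S\<close>, with norm at most a constant times
  the norm of \<open>v\<close> times the supremum over \<open>t\<close> of the norms of \<open>t * w\<close>, because translations are
  contractive on the Figa-Talamanca--Herz algebra. Hence the series defining an element of the
  Feichtinger algebra converges absolutely in \<open>S\<close>, and its limit there is the pointwise one.
\<close>

section \<open>Left Haar measure\<close>

lemma left_haar_measureD:
  assumes "left_haar_measure m"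
  shows sets_left_haar_measure: "sets m = sets borel"
    and space_left_haar_measure: "space m = UNIV"
    and emeasure_left_haar_measure_compact: "compact C \<Longrightarrow> emeasure m C < \<infinity>"
    and emeasure_left_haar_measure_translate:
      "A \<in> sets borel \<Longrightarrow> emeasure m ((\<lambda>s. t + s) ` A) = emeasure m A"
proof -
  show sets: "sets m = sets borel" using assms unfolding left_haar_measure_def by (elim conjE)
  show "space m = UNIV" using sets_eq_imp_space_eq[OF sets] by simp
  show "emeasure m C < \<infinity>" if "compact C"
    using assms that unfolding left_haar_measure_def by (elim conjE) (erule allE, erule mp)
  show "emeasure m ((\<lambda>s. t + s) ` A) = emeasure m A" if "A \<in> sets borel"
    using assms that unfolding left_haar_measure_def by (elim conjE) (erule allE, erule bspec)
qed

lemma measurable_left_add: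
  fixes m :: "'g::topological_group_add measure"
  assumes "left_haar_measure m"
  shows "(\<lambda>s. t + s) \<in> measurable m m"
proof -
  have "(\<lambda>s::'g. t + s) \<in> borel \<rightarrow>\<^sub>M borel"
    by (intro borel_measurable_continuous_onI continuous_intros)
  then show ?thesis
    using measurable_cong_sets[OF sets_left_haar_measure[OF assms] sets_left_haar_measure[OF assms]]
    by simp
qed

text \<open>Invariance is assumed for image sets; the preimage of \<open>A\<close> under translation
  by \<open>t\<close> is the image under translation by \<open>- t\<close>. In this form it yields
  the change of variables for integrals.\<close>

lemma distr_left_haar_measure:
  fixes m :: "'g::topological_group_add measure"
  assumes "left_haar_measure m"
  shows "distr m m (\<lambda>s. t + s) = m"
proof (rule measure_eqI)
  fix A assume "A \<in> sets (distr m m (\<lambda>s. t + s))"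
  then have A: "A \<in> sets m" by simp
  have "(\<lambda>s. t + s) -` A = (\<lambda>s. - t + s) ` A"
    by (force simp: image_iff add.assoc[symmetric])
  then show "emeasure (distr m m (\<lambda>s. t + s)) A = emeasure m A"
    using A assms measurable_left_add[OF assms, of t]
    by (simp add: emeasure_distr space_left_haar_measure sets_left_haar_measure
        emeasure_left_haar_measure_translate)
qed simp

lemma integral_left_haar_measure:
  fixes f :: "'g::topological_group_add \<Rightarrow> 'a::{banach, second_countable_topology}"
  assumes "left_haar_measure m" "f \<in> borel_measurable m"
  shows "(LINT s|m. f (t + s)) = (LINT s|m. f s)"
  using integral_distr[OF measurable_left_add[OF assms(1), of t] assms(2)]
  by (simp add: distr_left_haar_measure[OF assms(1)])

lemma integrable_left_haar_measure:
  fixes f :: "'g::topological_group_add \<Rightarrow> 'a::{banach, second_countable_topology}"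
  assumes "left_haar_measure m" "f \<in> borel_measurable m"
  shows "integrable m (\<lambda>s. f (t + s)) \<longleftrightarrow> integrable m f"
  using integrable_distr_eq[OF measurable_left_add[OF assms(1), of t] assms(2)]
  by (simp add: distr_left_haar_measure[OF assms(1)])

text \<open>If \<open>U\<close> were null, every compact set would be covered by finitely many null
  translates of \<open>U\<close>. Inner regularity would then make the whole group null.\<close>

lemma emeasure_left_haar_measure_open_neq_0:
  fixes U :: "'g::topological_group_add set"
  assumes haar: "left_haar_measure m" and U: "open U" "U \<noteq> {}"
  shows "emeasure m U \<noteq> 0"
proof
  assume null: "emeasure m U = 0"
  obtain x where x: "x \<in> U" using U by blast
  have op: "open ((\<lambda>s. t + s) ` U)" for t
  proof -
    have "(\<lambda>s. t + s) ` U = (\<lambda>s. - t + s) -` U"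
      by (force simp: image_iff add.assoc[symmetric])
    moreover have "open ((\<lambda>s. - t + s) -` U)"
      using U(1) by (intro open_vimage continuous_intros)
    ultimately show ?thesis by simp
  qed
  have "emeasure m C = 0" if C: "compact C" for C
  proof -
    \<comment> \<open>Translation by \<open>t + - x\<close> carries \<open>x\<close> to
      \<open>t\<close>, so the translate of \<open>U\<close> belonging to \<open>t\<close> contains
      \<open>t\<close>.\<close>
    have "C \<subseteq> (\<Union>t\<in>C. (\<lambda>s. t + - x + s) ` U)"
      using x by (force simp: image_iff add.assoc)
    then obtain D where D: "D \<subseteq> C" "finite D" "C \<subseteq> (\<Union>t\<in>D. (\<lambda>s. t + - x + s) ` U)"
      using compactE_image[OF C, of C "\<lambda>t. (\<lambda>s. t + - x + s) ` U"] op by blast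
    have "emeasure m C \<le> emeasure m (\<Union>t\<in>D. (\<lambda>s. t + - x + s) ` U)"
      using op by (intro emeasure_mono[OF D(3)])
        (simp add: sets_left_haar_measure[OF haar] borel_open open_UN)
    also have "\<dots> \<le> (\<Sum>t\<in>D. emeasure m ((\<lambda>s. t + - x + s) ` U))"
      using op by (intro emeasure_subadditive_finite[OF D(2)])
        (auto simp: sets_left_haar_measure[OF haar] intro!: borel_open)
    also have "\<dots> = 0"
      using U null by (simp add: emeasure_left_haar_measure_translate[OF haar])
    finally show ?thesis by simp
  qed
  then have "(SUP C\<in>{C. compact C \<and> C \<subseteq> UNIV}. emeasure m C) \<le> 0"
    by (intro SUP_least) simp
  moreover have "emeasure m UNIV = (SUP C\<in>{C. compact C \<and> C \<subseteq> UNIV}. emeasure m C)"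
    using haar unfolding left_haar_measure_def by blast
  moreover have "emeasure m UNIV \<noteq> 0" using haar unfolding left_haar_measure_def by blast
  ultimately show False by (simp only: le_zero_eq)
qed

lemma compact_set_plus:
  fixes K L :: "'g::topological_monoid_add set"
  assumes "compact K" "compact L"
  shows "compact ((\<lambda>(x, y). x + y) ` (K \<times> L))"
  using assms
  by (intro compact_continuous_image compact_Times)
    (auto simp: split_def intro!: continuous_intros)

section \<open>Lebesgue spaces and Hoelder's inequality\<close>

lemma conj_exponent_gt_1: "1 < p \<Longrightarrow> 1 < conj_exponent p"
  by (simp add: conj_exponent_def)

lemma Lp_norm_nonneg: "0 \<le> Lp_norm m p f"
  by (simp add: Lp_norm_def)

text \<open>Hoelder's inequality: Young's inequality is applied pointwise to the functions divided
  by their norms, and then integrated.\<close>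

lemma norm_LINT_mult_le_Lp_norm:
  assumes pq: "1 < p" "1 < q" "1 / p + 1 / q = 1"
    and f: "f \<in> Lp_space m p" and g: "g \<in> Lp_space m q"
  shows "norm (LINT s|m. f s * g s) \<le> Lp_norm m p f * Lp_norm m q g"
proof -
  have [measurable]: "f \<in> borel_measurable m" "g \<in> borel_measurable m"
    and int: "integrable m (\<lambda>s. norm (f s) powr p)" "integrable m (\<lambda>s. norm (g s) powr q)"
    using f g by (auto simp: Lp_space_def)
  let ?A = "LINT s|m. norm (f s) powr p" and ?B = "LINT s|m. norm (g s) powr q"
  have nn: "0 \<le> ?A" "0 \<le> ?B" by simp_all
  show ?thesis
  \<comment> \<open>Normalising divides by both norms. If one of them vanishes, that function is
    zero almost everywhere, and so is the product.\<close>
  proof (cases "?A = 0 \<or> ?B = 0")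
    case True
    then have "(AE s in m. norm (f s) powr p = 0) \<or> (AE s in m. norm (g s) powr q = 0)"
      using int by (simp add: integral_nonneg_eq_0_iff_AE)
    then have "AE s in m. f s * g s = 0" by (auto elim: eventually_mono)
    then have "(LINT s|m. f s * g s) = 0" by (rule integral_eq_zero_AE)
    then show ?thesis by (simp add: Lp_norm_nonneg)
  next
    case False
    with nn have pos: "0 < ?A" "0 < ?B" by (auto simp: less_le)
    let ?a = "Lp_norm m p f" and ?b = "Lp_norm m q g"
    have ab: "0 < ?a" "0 < ?b" using pos by (simp_all add: Lp_norm_def)
    have pow: "?a powr p = ?A" "?b powr q = ?B"
      using pq pos by (simp_all add: Lp_norm_def powr_powr)
    have young: "norm (f s * g s) \<le>
        ?a * ?b * (norm (f s) powr p / (?A * p) + norm (g s) powr q / (?B * q))" for s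
    proof -
      have "norm (f s) / ?a * (norm (g s) / ?b) \<le>
          (norm (f s) / ?a) powr p / p + (norm (g s) / ?b) powr q / q"
        using pq ab by (intro Youngs_inequality) auto
      also have "\<dots> = norm (f s) powr p / (?A * p) + norm (g s) powr q / (?B * q)"
        using ab by (simp add: powr_divide pow)
      finally have "?a * ?b * (norm (f s) / ?a * (norm (g s) / ?b)) \<le>
          ?a * ?b * (norm (f s) powr p / (?A * p) + norm (g s) powr q / (?B * q))"
        using ab by (intro mult_left_mono) auto
      then show ?thesis using ab by (simp add: norm_mult)
    qed
    have "norm (LINT s|m. f s * g s) \<le>
        (LINT s|m. ?a * ?b * (norm (f s) powr p / (?A * p) + norm (g s) powr q / (?B * q)))"
    proof (rule order_trans[OF integral_norm_bound integral_mono])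
      show int': "integrable m
          (\<lambda>s. ?a * ?b * (norm (f s) powr p / (?A * p) + norm (g s) powr q / (?B * q)))"
        using int by simp
      \<comment> \<open>The integrable majorant from Young's inequality also supplies the
        integrability of the product.\<close>
      show "integrable m (\<lambda>s. norm (f s * g s))"
        by (rule Bochner_Integration.integrable_bound[OF int'])
          (auto intro!: AE_I2 order_trans[OF young])
    qed (rule young)
    also have "\<dots> = ?a * ?b * (?A / (?A * p) + ?B / (?B * q))"
      using int by simp
    also have "\<dots> = ?a * ?b * (1 / p + 1 / q)" using pos by simp
    also have "\<dots> = ?a * ?b" by (simp add: pq(3))
    finally show ?thesis .
  qed
qed

lemma
  fixes m :: "'g::topological_group_add measure"
  assumes haar: "left_haar_measure m" and f: "f \<in> Lp_space m p"
  shows translate_in_Lp_space: "translate t f \<in> Lp_space m p"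
    and Lp_norm_translate: "Lp_norm m p (translate t f) = Lp_norm m p f"
proof -
  have [measurable]: "f \<in> borel_measurable m" using f by (simp add: Lp_space_def)
  have [measurable]: "translate t f \<in> borel_measurable m"
    unfolding translate_def by (rule measurable_compose[OF measurable_left_add[OF haar]]) measurable
  show "translate t f \<in> Lp_space m p"
    using f integrable_left_haar_measure[OF haar, of "\<lambda>s. norm (f s) powr p" "- t"]
    by (simp add: Lp_space_def) (simp add: translate_def)
  show "Lp_norm m p (translate t f) = Lp_norm m p f"
    using integral_left_haar_measure[OF haar, of "\<lambda>s. norm (f s) powr p" "- t"]
    by (simp add: Lp_norm_def) (simp add: translate_def)
qed

text \<open>Since \<open>check g (- t + s) = g (- s + t)\<close>, the convolution is a pairing of
  \<open>f\<close> with a left translate of \<open>g\<close>. The Haar measure never has to be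
  inverted, so no modular function appears.\<close>

lemma conv_check: "conv m f (check g) s = (LINT t|m. f t * translate s g t)"
  by (simp add: conv_def check_def translate_def minus_add)

text \<open>In the pairing form, substitute \<open>t + r\<close> for the integration variable
  \<open>r\<close>: the translation moves from \<open>f\<close> into the argument of the
  convolution.\<close>

lemma conv_translate_check:
  fixes m :: "'g::topological_group_add measure"
  assumes haar: "left_haar_measure m"
    and f: "f \<in> borel_measurable m" and g: "g \<in> borel_measurable m"
  shows "conv m (translate t f) (check g) s = conv m f (check g) (- t + s)"
proof -
  have "(\<lambda>r. translate t f r * translate s g r) \<in> borel_measurable m"
    unfolding translate_def
    by (intro borel_measurable_times measurable_compose[OF measurable_left_add[OF haar]] f g)
  from integral_left_haar_measure[OF haar this, of t, symmetric] show ?thesis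
    unfolding conv_check
    by (simp add: translate_def minus_add add.assoc[symmetric])
qed

text \<open>Hoelder's inequality for the pairing form; by left invariance the translate of
  \<open>g\<close> has the same norm as \<open>g\<close>.\<close>

lemma norm_conv_check_le:
  fixes m :: "'g::topological_group_add measure"
  assumes "1 < p" "left_haar_measure m" "f \<in> Lp_space m (conj_exponent p)" "g \<in> Lp_space m p"
  shows "norm (conv m f (check g) s) \<le> Lp_norm m (conj_exponent p) f * Lp_norm m p g"
  using norm_LINT_mult_le_Lp_norm[of "conj_exponent p" p f m "translate s g"] assms
  by (simp add: conv_check translate_in_Lp_space Lp_norm_translate conj_exponent_gt_1
      conj_exponent add.commute)

lemma indicator_in_Lp_space:
  assumes "A \<in> sets m" "emeasure m A < \<infinity>"
  shows "(\<lambda>s. complex_of_real (c * indicator A s)) \<in> Lp_space m p"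
proof -
  have "(\<lambda>s. norm (complex_of_real (c * indicator A s)) powr p) = (\<lambda>s. \<bar>c\<bar> powr p * indicator A s)"
    by (auto simp: indicator_def)
  then show ?thesis using assms by (simp add: Lp_space_def del: of_real_mult)
qed

section \<open>The Figa-Talamanca--Herz algebra\<close>

lemma Ap_norm_bdd_below:
  "bdd_below {(\<Sum>i. Lp_norm m (conj_exponent p) (\<xi> i) * Lp_norm m p (\<eta> i)) |\<xi> \<eta>.
     Ap_represents m p \<xi> \<eta> u}"
  by (rule bdd_belowI[of _ 0]) (auto simp: Ap_represents_def Lp_norm_nonneg intro!: suminf_nonneg)

text \<open>The termwise Hoelder bound shows that the cost of every representation of
  \<open>u\<close> dominates \<open>norm (u s)\<close>, hence so does the infimum. This is what
  later turns norm limits into pointwise limits.\<close>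

lemma norm_le_Ap_norm:
  fixes m :: "'g::topological_group_add measure"
  assumes "1 < p" "left_haar_measure m" "u \<in> Ap m p"
  shows "norm (u s) \<le> Ap_norm m p u"
  unfolding Ap_norm_def
proof (rule cInf_greatest)
  fix x assume "x \<in> {(\<Sum>i. Lp_norm m (conj_exponent p) (\<xi> i) * Lp_norm m p (\<eta> i)) |\<xi> \<eta>.
    Ap_represents m p \<xi> \<eta> u}"
  then obtain \<xi> \<eta> where x: "x = (\<Sum>i. Lp_norm m (conj_exponent p) (\<xi> i) * Lp_norm m p (\<eta> i))"
    and r: "Ap_represents m p \<xi> \<eta> u" by blast
  have le: "norm (conv m (\<xi> i) (check (\<eta> i)) s) \<le>
      Lp_norm m (conj_exponent p) (\<xi> i) * Lp_norm m p (\<eta> i)" for i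
    using r assms by (intro norm_conv_check_le) (auto simp: Ap_represents_def)
  have "u s = (\<Sum>i. conv m (\<xi> i) (check (\<eta> i)) s)"
    using r by (auto simp: Ap_represents_def dest: sums_unique)
  then show "norm (u s) \<le> x"
    using norm_suminf_le[OF le] r unfolding x Ap_represents_def by simp
qed (use assms in \<open>auto simp: Ap_def\<close>)

lemma Ap_norm_nonneg:
  fixes m :: "'g::topological_group_add measure"
  assumes "1 < p" "left_haar_measure m" "u \<in> Ap m p"
  shows "0 \<le> Ap_norm m p u"
  using norm_le_Ap_norm[OF assms, of 0] norm_ge_zero order_trans by blast

text \<open>Left translation acts on the first convolution factors alone, and these keep their
  norms.\<close>

lemma Ap_represents_translate:
  fixes m :: "'g::topological_group_add measure"
  assumes haar: "left_haar_measure m" and "Ap_represents m p \<xi> \<eta> u"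
  shows "Ap_represents m p (\<lambda>i. translate t (\<xi> i)) \<eta> (translate t u)"
proof -
  have "conv m (translate t (\<xi> i)) (check (\<eta> i)) s = conv m (\<xi> i) (check (\<eta> i)) (- t + s)" for i s
    using assms by (intro conv_translate_check) (auto simp: Ap_represents_def Lp_space_def)
  then show ?thesis
    using assms unfolding Ap_represents_def
    by (auto simp: translate_in_Lp_space Lp_norm_translate translate_def[of t u])
qed

lemma translate_in_Ap:
  fixes m :: "'g::topological_group_add measure"
  assumes "left_haar_measure m" "u \<in> Ap m p"
  shows "translate t u \<in> Ap m p"
  using assms Ap_represents_translate unfolding Ap_def by blast

text \<open>Each representation of \<open>u\<close> gives one of its translate at the same cost, so
  the infimum for the translate runs over a superset.\<close>

lemma Ap_norm_translate_le:
  fixes m :: "'g::topological_group_add measure"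
  assumes haar: "left_haar_measure m" and "u \<in> Ap m p"
  shows "Ap_norm m p (translate t u) \<le> Ap_norm m p u"
  unfolding Ap_norm_def
proof (rule cInf_superset_mono[OF _ Ap_norm_bdd_below])
  show "{(\<Sum>i. Lp_norm m (conj_exponent p) (\<xi> i) * Lp_norm m p (\<eta> i)) |\<xi> \<eta>.
      Ap_represents m p \<xi> \<eta> u} \<subseteq>
    {(\<Sum>i. Lp_norm m (conj_exponent p) (\<xi> i) * Lp_norm m p (\<eta> i)) |\<xi> \<eta>.
      Ap_represents m p \<xi> \<eta> (translate t u)}"
  proof clarify
    fix \<xi> \<eta> assume r: "Ap_represents m p \<xi> \<eta> u"
    then have "Lp_norm m (conj_exponent p) (translate t (\<xi> i)) = Lp_norm m (conj_exponent p) (\<xi> i)"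
      for i using haar by (auto simp: Ap_represents_def Lp_norm_translate)
    then show "\<exists>\<xi>' \<eta>'. (\<Sum>i. Lp_norm m (conj_exponent p) (\<xi> i) * Lp_norm m p (\<eta> i)) =
        (\<Sum>i. Lp_norm m (conj_exponent p) (\<xi>' i) * Lp_norm m p (\<eta>' i)) \<and>
        Ap_represents m p \<xi>' \<eta>' (translate t u)"
      by (intro exI[of _ "\<lambda>i. translate t (\<xi> i)"] exI[of _ \<eta>] conjI
          Ap_represents_translate[OF haar r]) simp
  qed
qed (use assms in \<open>auto simp: Ap_def\<close>)

text \<open>Reduces to interleaving real series by taking real and imaginary parts.\<close>

lemma sums_if_complex:
  fixes f g :: "nat \<Rightarrow> complex"
  assumes "g sums x" "f sums y"
  shows "(\<lambda>n. if even n then f (n div 2) else g ((n - 1) div 2)) sums (x + y)"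
proof -
  have "(\<lambda>n. if even n then Re (f (n div 2)) else Re (g ((n - 1) div 2))) sums (Re x + Re y)"
    "(\<lambda>n. if even n then Im (f (n div 2)) else Im (g ((n - 1) div 2))) sums (Im x + Im y)"
    using assms by (auto simp: sums_complex_iff intro!: sums_if)
  then show ?thesis by (simp add: sums_complex_iff if_distrib)
qed

text \<open>Two representations are interleaved into one: even indices carry the terms of
  \<open>v\<close>, odd indices those of \<open>u\<close>.\<close>

lemma add_in_Ap:
  assumes "u \<in> Ap m p" "v \<in> Ap m p"
  shows "u + v \<in> Ap m p"
proof -
  let ?L = "\<lambda>\<xi> \<eta> i. Lp_norm m (conj_exponent p) (\<xi> i) * Lp_norm m p (\<eta> i)"
  let ?c = "\<lambda>f g n::nat. if even n then g (n div 2) else f ((n - 1) div 2)"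
  obtain \<xi> \<eta> \<xi>' \<eta>' where u: "Ap_represents m p \<xi> \<eta> u" and v: "Ap_represents m p \<xi>' \<eta>' v"
    using assms by (auto simp: Ap_def)
  have "?c (?L \<xi> \<eta>) (?L \<xi>' \<eta>') sums (suminf (?L \<xi> \<eta>) + suminf (?L \<xi>' \<eta>'))"
    using u v by (intro sums_if) (auto simp: Ap_represents_def)
  moreover have "?c (?L \<xi> \<eta>) (?L \<xi>' \<eta>') = ?L (?c \<xi> \<xi>') (?c \<eta> \<eta>')" by auto
  ultimately have "summable (?L (?c \<xi> \<xi>') (?c \<eta> \<eta>'))" by (simp add: sums_iff)
  moreover have "(\<lambda>i. conv m (?c \<xi> \<xi>' i) (check (?c \<eta> \<eta>' i)) s) sums (u s + v s)" for s
  proof -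
    have "?c (\<lambda>i. conv m (\<xi> i) (check (\<eta> i)) s) (\<lambda>i. conv m (\<xi>' i) (check (\<eta>' i)) s)
        sums (u s + v s)"
      using u v by (intro sums_if_complex) (auto simp: Ap_represents_def)
    moreover have "?c (\<lambda>i. conv m (\<xi> i) (check (\<eta> i)) s) (\<lambda>i. conv m (\<xi>' i) (check (\<eta>' i)) s) =
        (\<lambda>i. conv m (?c \<xi> \<xi>' i) (check (?c \<eta> \<eta>' i)) s)" by auto
    ultimately show ?thesis by simp
  qed
  ultimately have "Ap_represents m p (?c \<xi> \<xi>') (?c \<eta> \<eta>') (u + v)"
    using u v by (simp add: Ap_represents_def)
  then show ?thesis unfolding Ap_def by blast
qed

lemma conv_check_in_Ap:
  assumes "f \<in> Lp_space m (conj_exponent p)" "g \<in> Lp_space m p"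
  shows "conv m f (check g) \<in> Ap m p"
proof -
  let ?\<xi> = "\<lambda>i::nat. if i = 0 then f else (\<lambda>_. 0)" and ?\<eta> = "\<lambda>i::nat. if i = 0 then g else (\<lambda>_. 0)"
  have "(\<lambda>i. Lp_norm m (conj_exponent p) (?\<xi> i) * Lp_norm m p (?\<eta> i)) =
      (\<lambda>i. if i = 0 then Lp_norm m (conj_exponent p) f * Lp_norm m p g else 0)"
    by (auto simp: Lp_norm_def)
  then have "summable (\<lambda>i. Lp_norm m (conj_exponent p) (?\<xi> i) * Lp_norm m p (?\<eta> i))"
    using sums_single[of 0 "\<lambda>_. Lp_norm m (conj_exponent p) f * Lp_norm m p g"]
    by (simp add: sums_iff)
  moreover have "(\<lambda>i. conv m (?\<xi> i) (check (?\<eta> i)) s) sums conv m f (check g) s" for s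
  proof -
    have "(\<lambda>i. conv m (?\<xi> i) (check (?\<eta> i)) s) = (\<lambda>i. if i = 0 then conv m f (check g) s else 0)"
      by (auto simp: conv_def)
    then show ?thesis using sums_single[of 0 "\<lambda>_. conv m f (check g) s"] by simp
  qed
  moreover have "(\<lambda>_. 0) \<in> Lp_space m r" for r by (simp add: Lp_space_def)
  ultimately have "Ap_represents m p ?\<xi> ?\<eta> (conv m f (check g))"
    using assms by (simp add: Ap_represents_def)
  then show ?thesis unfolding Ap_def by blast
qed

text \<open>The local unit pairs the indicator of \<open>K + K\<close> with the indicator of
  \<open>K\<close> divided by the measure of \<open>K\<close>. For \<open>s\<close> in
  \<open>K\<close> the translate \<open>s + K\<close> lies inside \<open>K + K\<close>, so the
  pairing is the full integral of the normalised indicator.\<close>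

lemma Ap_eq_1_on_compact:
  fixes K :: "'g::{topological_group_add, t2_space} set"
  assumes haar: "left_haar_measure m" and K: "compact K" "interior K \<noteq> {}"
  shows "\<exists>a\<in>Ap m p. \<forall>s\<in>K. a s = 1"
proof -
  let ?L = "(\<lambda>(x, y). x + y) ` (K \<times> K)"
  have compL: "compact ?L" using K by (intro compact_set_plus)
  have Ks: "K \<in> sets m" and Ls: "?L \<in> sets m"
    using K(1) compL unfolding sets_left_haar_measure[OF haar]
    by (simp_all only: borel_closed compact_imp_closed)
  have Kf: "emeasure m K < \<infinity>" and Lf: "emeasure m ?L < \<infinity>"
    by (rule emeasure_left_haar_measure_compact[OF haar K(1)],
        rule emeasure_left_haar_measure_compact[OF haar compL])
  have "emeasure m (interior K) \<le> emeasure m K"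
    using Ks interior_subset by (intro emeasure_mono)
  then have "emeasure m K \<noteq> 0"
    using emeasure_left_haar_measure_open_neq_0[OF haar open_interior K(2)] by auto
  \<comment> \<open>\<open>measure\<close> is 0 at infinite values too, so finiteness is required
    alongside \<open>emeasure m K \<noteq> 0\<close>.\<close>
  with Kf have mK: "measure m K \<noteq> 0" by (auto simp: measure_def enn2real_eq_0_iff)
  let ?\<xi> = "\<lambda>s. complex_of_real (1 * indicator ?L s)"
  let ?\<eta> = "\<lambda>s. complex_of_real (1 / measure m K * indicator K s)"
  have mem: "conv m ?\<xi> (check ?\<eta>) \<in> Ap m p"
    by (intro conv_check_in_Ap indicator_in_Lp_space Ks Ls Kf Lf)
  have "conv m ?\<xi> (check ?\<eta>) s = 1" if s: "s \<in> K" for s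
  proof -
    \<comment> \<open>Where the second factor is nonzero, \<open>t = s + (- s + t)\<close> lies in
      \<open>K + K\<close> and the first factor is 1.\<close>
    have "?\<xi> t * translate s ?\<eta> t = ?\<eta> (- s + t)" for t
    proof (cases "- s + t \<in> K")
      case True
      then have "t \<in> ?L"
        using s by (intro image_eqI[of _ _ "(s, - s + t)"]) (auto simp: add.assoc[symmetric])
      then show ?thesis by (simp add: translate_def)
    qed (simp add: translate_def)
    then have "conv m ?\<xi> (check ?\<eta>) s = (LINT t|m. ?\<eta> (- s + t))"
      by (simp add: conv_check)
    also have "\<dots> = (LINT t|m. ?\<eta> t)"
      using indicator_in_Lp_space[OF Ks Kf]
      by (intro integral_left_haar_measure[OF haar]) (auto simp only: Lp_space_def)
    also have "\<dots> = complex_of_real (LINT t|m. 1 / measure m K * indicator K t)"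
      by (rule integral_complex_of_real)
    also have "\<dots> = 1"
      using mK Ks Kf by (simp add: space_left_haar_measure[OF haar])
    finally show ?thesis .
  qed
  then show ?thesis using mem by blast
qed

section \<open>Series in Banach spaces of functions\<close>

lemma function_subspace_sum:
  assumes "function_subspace S" "\<And>i. i \<in> I \<Longrightarrow> f i \<in> S"
  shows "(\<Sum>i\<in>I. f i) \<in> S"
  using assms(2)
  by (induction I rule: infinite_finite_induct) (use assms(1) in \<open>auto simp: function_subspace_def\<close>)

lemma norm_on_sum_le:
  assumes "function_subspace S" "norm_on S N" "\<And>i. i \<in> I \<Longrightarrow> f i \<in> S"
  shows "N (\<Sum>i\<in>I. f i) \<le> (\<Sum>i\<in>I. N (f i))"
  using assms(3)
proof (induction I rule: infinite_finite_induct)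
  case (insert x I)
  then have "N (f x + sum f I) \<le> N (f x) + N (sum f I)"
    using assms function_subspace_sum[OF assms(1), of I f] by (simp add: norm_on_def)
  with insert show ?case by (auto simp: plus_fun_def)
qed (use assms in \<open>auto simp: norm_on_def function_subspace_def\<close>)

lemma sum_fun_apply: "(\<Sum>i\<in>I. f i) x = (\<Sum>i\<in>I. f i x)"
  by (induction I rule: infinite_finite_induct) auto

lemma function_subspace_diff:
  assumes "function_subspace S" "u \<in> S" "v \<in> S"
  shows "u - v \<in> S"
proof -
  have "u + (\<lambda>s. (- 1) * v s) \<in> S" using assms unfolding function_subspace_def by blast
  moreover have "u + (\<lambda>s. (- 1) * v s) = u - v" by (simp add: fun_eq_iff)
  ultimately show ?thesis by simp
qed

text \<open>Absolute convergence makes the partial sums Cauchy, so they converge in \<open>N\<close>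
  to some element of \<open>S\<close>. As \<open>N\<close> controls point values, that element is
  the given pointwise sum.\<close>

lemma sums_in_banach_function_space:
  assumes B: "banach_function_space S N"
    and bound: "\<And>u s. u \<in> S \<Longrightarrow> norm (u s) \<le> C * N u"
    and f: "\<And>n. f n \<in> S" "summable (\<lambda>n. N (f n))"
    and sums: "\<And>s. (\<lambda>n. f n s) sums u s"
  shows "u \<in> S"
proof -
  have sub: "function_subspace S" and nrm: "norm_on S N" and comp: "complete_in_norm S N"
    using B by (auto simp: banach_function_space_def)
  define F where "F n = (\<Sum>i<n. f i)" for n
  have FS: "F n \<in> S" for n unfolding F_def using f by (intro function_subspace_sum[OF sub])
  have Nneg: "N (F i - F j) = N (F j - F i)" for i j
  proof -
    have "(\<lambda>s. (- 1) * (F j - F i) s) = F i - F j" by (simp add: fun_eq_iff)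
    then show ?thesis
      using nrm function_subspace_diff[OF sub FS FS, of j i] unfolding norm_on_def
      by (metis mult_1 norm_minus_cancel norm_one)
  qed
  have diff: "N (F j - F i) \<le> (\<Sum>k=i..<j. N (f k))" if "i \<le> j" for i j
  proof -
    have "F j - F i = (\<Sum>k=i..<j. f k)"
      using sum_diff_nat_ivl[of 0 i j f] that by (simp add: F_def atLeast0LessThan)
    then show ?thesis using norm_on_sum_le[OF sub nrm, of "{i..<j}" f] f by simp
  qed
  have "\<exists>M. \<forall>i\<ge>M. \<forall>j\<ge>M. N (F i - F j) < e" if e: "e > 0" for e
  proof -
    obtain M where M: "\<And>i j. i \<ge> M \<Longrightarrow> norm (\<Sum>k=i..<j. N (f k)) < e"
      using f(2) e unfolding summable_Cauchy by blast
    have "N (F i - F j) < e" if "i \<ge> M" "j \<ge> M" for i j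
      using diff[of i j] diff[of j i] Nneg[of i j] M[of i j] M[of j i] that
      by (cases "i \<le> j") (auto simp: not_le)
    then show ?thesis by blast
  qed
  then obtain w where w: "w \<in> S" "(\<lambda>n. N (F n - w)) \<longlonglongrightarrow> 0"
    using comp FS unfolding complete_in_norm_def by blast
  have "w s = u s" for s
  proof -
    have "(\<lambda>n. F n s - w s) \<longlonglongrightarrow> 0"
    proof (rule Lim_null_comparison)
      show "(\<lambda>n. C * N (F n - w)) \<longlonglongrightarrow> 0" using w(2) by (rule tendsto_mult_right_zero)
      have "norm (F n s - w s) \<le> C * N (F n - w)" for n
        using bound[OF function_subspace_diff[OF sub FS w(1)], of n s] by simp
      then show "\<forall>\<^sub>F n in sequentially. norm (F n s - w s) \<le> C * N (F n - w)"
        by (intro always_eventually allI)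
    qed
    then have "(\<lambda>n. F n s) \<longlonglongrightarrow> w s" by (simp add: LIM_zero_iff)
    moreover have "(\<lambda>n. F n s) \<longlonglongrightarrow> u s"
      using sums[of s] by (simp add: sums_def F_def sum_fun_apply)
    ultimately show ?thesis by (rule LIMSEQ_unique)
  qed
  then have "w = u" by blast
  with w show ?thesis by simp
qed

text \<open>A summable family of norms has only countably many nonzero members. Enumerating these
  reduces an arbitrary index set to a sequence.\<close>

lemma has_sum_in_banach_function_space:
  assumes B: "banach_function_space S N"
    and bound: "\<And>u s. u \<in> S \<Longrightarrow> norm (u s) \<le> C * N u"
    and f: "\<And>i. i \<in> I \<Longrightarrow> f i \<in> S" "(\<lambda>i. N (f i)) summable_on I"
    and sums: "\<And>s. ((\<lambda>i. f i s) has_sum u s) I"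
  shows "u \<in> S"
proof -
  have N0: "N v = 0 \<longleftrightarrow> v = 0" if "v \<in> S" for v
    using B that by (auto simp: banach_function_space_def function_subspace_def norm_on_def)
  have zeroS: "0 \<in> S" and N00: "N 0 = 0"
    using B by (auto simp: banach_function_space_def function_subspace_def norm_on_def)
  define D where "D = {i\<in>I. N (f i) \<noteq> 0}"
  have DI: "D \<subseteq> I" by (auto simp: D_def)
  have cD: "countable D" unfolding D_def using f(2) by (rule summable_countable_real)
  define e where "e = to_nat_on D"
  have inj: "inj_on e D" unfolding e_def by (rule inj_on_to_nat_on[OF cD])
  \<comment> \<open>Padding by 0 outside the range of the enumeration also covers finite
    \<open>D\<close>, and changes neither the norm sum nor the pointwise sums.\<close>
  define g where "g n = (if n \<in> e ` D then f (inv_into D e n) else 0)" for n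
  have ge: "g (e i) = f i" if "i \<in> D" for i using that inj by (simp add: g_def)
  have gS: "g n \<in> S" for n
    using f(1) zeroS inv_into_into[of n e D] by (auto simp: g_def D_def)
  \<comment> \<open>Definiteness of the norm: the discarded indices carry the zero function, not
    merely terms of norm zero.\<close>
  have fD: "f i = 0" if "i \<in> I - D" for i using that f(1)[of i] N0[of "f i"] by (auto simp: D_def)
  have "(\<lambda>i. N (f i)) summable_on D"
    using f(2) by (rule summable_on_subset) (auto simp: D_def)
  then have "(\<lambda>n. N (g n)) summable_on (e ` D)"
    by (subst summable_on_reindex[OF inj]) (simp add: o_def ge cong: summable_on_cong)
  moreover have "(\<lambda>n. N (g n)) summable_on (e ` D) \<longleftrightarrow> (\<lambda>n. N (g n)) summable_on UNIV"
    by (rule summable_on_cong_neutral) (auto simp: g_def N00)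
  ultimately have "(\<lambda>n. N (g n)) summable_on UNIV" by simp
  then have gN: "summable (\<lambda>n. N (g n))" by (rule summable_on_imp_summable)
  have gu: "(\<lambda>n. g n s) sums u s" for s
  proof -
    have "((\<lambda>i. f i s) has_sum u s) I \<longleftrightarrow> ((\<lambda>i. g (e i) s) has_sum u s) D"
      using DI by (intro has_sum_cong_neutral) (auto simp: fD ge)
    also have "\<dots> \<longleftrightarrow> ((\<lambda>n. g n s) has_sum u s) (e ` D)"
      by (simp add: has_sum_reindex[OF inj] o_def)
    also have "\<dots> \<longleftrightarrow> ((\<lambda>n. g n s) has_sum u s) UNIV"
      by (rule has_sum_cong_neutral) (auto simp: g_def)
    finally show ?thesis using sums[of s] by (intro has_sum_imp_sums) (rule iffD1)
  qed
  show ?thesis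
    by (rule sums_in_banach_function_space[OF B]) (fact bound, fact gS, fact gN, fact gu)
qed

section \<open>Segal algebras in the Figa-Talamanca--Herz algebra\<close>

text \<open>The bounded inclusion into \<open>Ap m p\<close> is combined with the domination of
  point values by \<open>Ap_norm\<close>.\<close>

lemma segal_algebra_norm_bound:
  fixes m :: "'g::topological_group_add measure"
  assumes p: "1 < p" and haar: "left_haar_measure m"
    and segal: "segal_algebra (Ap m p) (Ap_norm m p) S NS"
  obtains C where "\<And>u s. u \<in> S \<Longrightarrow> norm (u s) \<le> C * NS u"
proof -
  obtain C where C: "\<forall>u\<in>S. Ap_norm m p u \<le> C * NS u" and sub: "S \<subseteq> Ap m p"
    using segal unfolding segal_algebra_def by blast
  have "norm (u s) \<le> C * NS u" if "u \<in> S" for u s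
    using norm_le_Ap_norm[OF p haar, of u s] C sub that by fastforce
  then show thesis by (rule that)
qed

text \<open>The module constant is raised to at least 1, so that the threshold
  \<open>1 / (2 * C)\<close> used below is positive and less than 1.\<close>

lemma segal_algebra_module_bound:
  fixes m :: "'g::topological_group_add measure"
  assumes p: "1 < p" and haar: "left_haar_measure m"
    and segal: "segal_algebra (Ap m p) (Ap_norm m p) S NS"
  obtains C where "1 \<le> C"
    and "\<And>a u. a \<in> Ap m p \<Longrightarrow> u \<in> S \<Longrightarrow> NS (a * u) \<le> C * Ap_norm m p a * NS u"
proof -
  obtain C where C: "\<forall>a\<in>Ap m p. \<forall>u\<in>S. NS (a * u) \<le> C * Ap_norm m p a * NS u"
    using segal unfolding segal_algebra_def by blast
  have "NS (a * u) \<le> max 1 C * Ap_norm m p a * NS u" if "a \<in> Ap m p" "u \<in> S" for a u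
  proof -
    have "0 \<le> NS u" using segal that
      by (auto simp: segal_algebra_def banach_function_space_def norm_on_def)
    then have "C * Ap_norm m p a * NS u \<le> max 1 C * Ap_norm m p a * NS u"
      using Ap_norm_nonneg[OF p haar that(1)] by (intro mult_right_mono) auto
    then show ?thesis using C that by fastforce
  qed
  then show thesis by (intro that[of "max 1 C"]) auto
qed

text \<open>
  A local unit \<open>a\<close> of the whole algebra is approximated by \<open>u \<in> S\<close>. With \<open>b = a - u\<close>, the Neumann
  series of \<open>u / (1 - b)\<close> converges in \<open>S\<close> because \<open>S\<close> is a module, and \<open>1 - b = u\<close> where \<open>a = 1\<close>.
\<close>

lemma segal_algebra_eq_1_on_compact:
  fixes m :: "'g::{topological_group_add, t2_space} measure"
  assumes p: "1 < p" and haar: "left_haar_measure m"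
    and segal: "segal_algebra (Ap m p) (Ap_norm m p) S NS"
    and K: "compact K" "interior K \<noteq> {}"
  shows "\<exists>w\<in>S. \<forall>s\<in>K. w s = 1"
proof -
  have SA: "S \<subseteq> Ap m p" and B: "banach_function_space S NS"
    and mult: "\<And>a u. a \<in> Ap m p \<Longrightarrow> u \<in> S \<Longrightarrow> a * u \<in> S"
    and dense: "\<And>a e. a \<in> Ap m p \<Longrightarrow> e > 0 \<Longrightarrow> \<exists>u\<in>S. Ap_norm m p (a - u) < e"
    using segal unfolding segal_algebra_def by blast+
  have sub: "function_subspace S" using B by (simp add: banach_function_space_def)
  have NS_nonneg: "0 \<le> NS v" if "v \<in> S" for v
    using B that by (simp add: banach_function_space_def norm_on_def)
  obtain C where C: "1 \<le> C"
    "\<And>a u. a \<in> Ap m p \<Longrightarrow> u \<in> S \<Longrightarrow> NS (a * u) \<le> C * Ap_norm m p a * NS u"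
    using segal_algebra_module_bound[OF p haar segal] by blast
  obtain C' where C': "\<And>u s. u \<in> S \<Longrightarrow> norm (u s) \<le> C' * NS u"
    using segal_algebra_norm_bound[OF p haar segal] by blast
  obtain a where a: "a \<in> Ap m p" "\<And>s. s \<in> K \<Longrightarrow> a s = 1"
    using Ap_eq_1_on_compact[OF haar K] by blast
  \<comment> \<open>This accuracy makes multiplication by \<open>a - u\<close> at least halve
    \<open>NS\<close>, and keeps the values of \<open>a - u\<close> below 1 in modulus.\<close>
  obtain u where u: "u \<in> S" "Ap_norm m p (a - u) < 1 / (2 * C)"
    using dense[OF a(1), of "1 / (2 * C)"] C(1) by auto
  define b where "b = a - u"
  \<comment> \<open>The negative is taken inside the subspace \<open>S\<close>, so that closure of
    \<open>Ap m p\<close> under addition gives \<open>a - u\<close>.\<close>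
  have "0 - u \<in> S" using sub u(1) by (intro function_subspace_diff) (auto simp: function_subspace_def)
  then have "a + (0 - u) \<in> Ap m p" using SA by (intro add_in_Ap a(1)) blast
  then have b: "b \<in> Ap m p" by (simp add: b_def)
  have Cb: "C * Ap_norm m p b \<le> 1 / 2" using u(2) C(1) by (simp add: b_def field_simps)
  have nb: "norm (b s) < 1" for s
  proof -
    have "norm (b s) < 1 / (2 * C)" using norm_le_Ap_norm[OF p haar b, of s] u(2) by (simp add: b_def)
    also have "\<dots> < 1" using C(1) by simp
    finally show ?thesis .
  qed
  \<comment> \<open>Each term keeps the factor \<open>u\<close>, so that it lies in
    \<open>S\<close>; the powers of \<open>b\<close> act through the module structure.\<close>
  define f where "f n = (\<lambda>s. b s ^ n * u s)" for n
  have fSuc: "f (Suc n) = b * f n" for n by (simp add: f_def fun_eq_iff)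
  have f: "f n \<in> S \<and> NS (f n) \<le> (1 / 2) ^ n * NS u" for n
  proof (induction n)
    case 0
    show ?case using u by (simp add: f_def)
  next
    case (Suc n)
    have "NS (f (Suc n)) \<le> C * Ap_norm m p b * NS (f n)" using C(2) b Suc by (simp add: fSuc)
    also have "\<dots> \<le> 1 / 2 * NS (f n)" using Suc NS_nonneg by (intro mult_right_mono Cb) blast
    also have "\<dots> \<le> 1 / 2 * ((1 / 2) ^ n * NS u)" using Suc by simp
    finally have "NS (f (Suc n)) \<le> (1 / 2) ^ Suc n * NS u" by simp
    moreover have "f (Suc n) \<in> S" unfolding fSuc using mult b Suc by blast
    ultimately show ?case by blast
  qed
  have fS: "f n \<in> S" for n using f by blast
  have fN: "summable (\<lambda>n. NS (f n))"
    by (rule summable_comparison_test'[where N = 0 and g = "\<lambda>n. (1 / 2) ^ n * NS u"])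
      (use f NS_nonneg in \<open>auto intro!: summable_mult2 summable_geometric\<close>)
  have fu: "(\<lambda>n. f n s) sums (1 / (1 - b s) * u s)" for s
    unfolding f_def by (intro sums_mult2 geometric_sums nb)
  have "(\<lambda>s. 1 / (1 - b s) * u s) \<in> S"
    by (rule sums_in_banach_function_space[OF B]) (fact C', fact fS, fact fN, fact fu)
  moreover have "1 / (1 - b s) * u s = 1" if "s \<in> K" for s
  proof -
    have "b s = 1 - u s" using a(2)[OF that] by (simp add: b_def)
    \<comment> \<open>If \<open>u s\<close> were 0, then \<open>b s\<close> would be 1, against
      \<open>nb\<close>. Hence the quotient is a genuine \<open>u s / u s\<close>.\<close>
    moreover from this have "u s \<noteq> 0" using nb[of s] by auto
    ultimately show ?thesis by simp
  qed
  ultimately show ?thesis by (intro bexI[of _ "\<lambda>s. 1 / (1 - b s) * u s"] ballI)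
qed

theorem theorem2p5:
  fixes m :: "'g::{topological_group_add, t2_space} measure"
    and p :: real
    and S :: "('g \<Rightarrow> complex) set"
    and NS :: "('g \<Rightarrow> complex) \<Rightarrow> real"
    and K :: "'g set"
  assumes "1 < p"
    and "locally_compact_space (euclidean :: 'g topology)"
    and "left_haar_measure m"
    and "segal_algebra (Ap m p) (Ap_norm m p) S NS"
    and "\<And>t u. u \<in> S \<Longrightarrow> translate t u \<in> S"
    and "\<And>u t0. u \<in> S \<Longrightarrow> ((\<lambda>t. NS (translate t u - translate t0 u)) \<longlongrightarrow> 0) (at t0)"
    and "\<And>u. u \<in> S \<Longrightarrow> bdd_above (range (\<lambda>t. NS (translate t u)))"
    and "compact K" and "interior K \<noteq> {}"
  shows "S0p m p K \<subseteq> S"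
proof
  fix u assume "u \<in> S0p m p K"
  then obtain v where v: "\<And>t. v t \<in> Ap m p" "\<And>t. supp (v t) \<subseteq> K"
    and summ: "(\<lambda>t. Ap_norm m p (v t)) summable_on UNIV"
    and u: "\<And>s. ((\<lambda>t. translate t (v t) s) has_sum u s) UNIV"
    by (auto simp: S0p_def Ap_supported_def)
  have B: "banach_function_space S NS"
    and mult: "\<And>a u. a \<in> Ap m p \<Longrightarrow> u \<in> S \<Longrightarrow> a * u \<in> S"
    using assms(4) unfolding segal_algebra_def by blast+
  have NS_nonneg: "0 \<le> NS f" if "f \<in> S" for f
    using B that by (simp add: banach_function_space_def norm_on_def)
  obtain C where C: "1 \<le> C"
    "\<And>a u. a \<in> Ap m p \<Longrightarrow> u \<in> S \<Longrightarrow> NS (a * u) \<le> C * Ap_norm m p a * NS u"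
    using segal_algebra_module_bound[OF assms(1,3,4)] by blast
  obtain C' where C': "\<And>u s. u \<in> S \<Longrightarrow> norm (u s) \<le> C' * NS u"
    using segal_algebra_norm_bound[OF assms(1,3,4)] by blast
  obtain w where w: "w \<in> S" "\<And>s. s \<in> K \<Longrightarrow> w s = 1"
    using segal_algebra_eq_1_on_compact[OF assms(1,3,4,8,9)] by blast
  obtain M where M: "\<And>t. NS (translate t w) \<le> M"
    using assms(7)[OF w(1)] by (auto simp: bdd_above_def)
  have eq: "translate t (v t) = translate t (v t) * translate t w" for t
  proof -
    have "v t s * w s = v t s" for s
      using v(2)[of t] w(2)[of s] closure_subset[of "{s. v t s \<noteq> 0}"]
      by (cases "v t s = 0") (auto simp: supp_def)
    then show ?thesis by (simp add: fun_eq_iff translate_def)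
  qed
  have A: "translate t (v t) \<in> Ap m p" for t by (intro translate_in_Ap assms(3) v)
  have inS: "translate t (v t) \<in> S" for t
    by (subst eq) (intro mult A assms(5) w)
  \<comment> \<open>The factor \<open>C * M\<close> is the same for all \<open>t\<close>; this
    uniformity is where boundedness of the orbit of \<open>w\<close> enters.\<close>
  have bound: "NS (translate t (v t)) \<le> C * M * Ap_norm m p (v t)" for t
  proof -
    have "NS (translate t (v t)) \<le> C * Ap_norm m p (translate t (v t)) * NS (translate t w)"
      by (subst eq) (intro C A assms(5) w)
    also have "\<dots> \<le> C * Ap_norm m p (v t) * M"
      using C(1) Ap_norm_nonneg[OF assms(1,3) A[of t]] Ap_norm_nonneg[OF assms(1,3) v(1)[of t]]
        Ap_norm_translate_le[OF assms(3) v(1)[of t]] NS_nonneg[OF assms(5)[OF w(1), of t]]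
      by (intro mult_mono mult_left_mono M mult_nonneg_nonneg) auto
    finally show ?thesis by (simp add: mult_ac)
  qed
  \<comment> \<open>Comparison over the whole group as index set; the passage to countably many
    terms takes place in \<open>has_sum_in_banach_function_space\<close>.\<close>
  have summS: "(\<lambda>t. NS (translate t (v t))) summable_on UNIV"
    by (rule summable_on_comparison_test[OF summable_on_cmult_right[OF summ, of "C * M"]])
      (use bound NS_nonneg inS in auto)
  show "u \<in> S"
    by (rule has_sum_in_banach_function_space[OF B, where I = UNIV and f = "\<lambda>t. translate t (v t)"])
      (fact C', rule inS, fact summS, fact u)
qed

end
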